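(* Let $\Omega\subset\mathbb{R}^{n}$ be a smoothly bounded domain and $p\in b\Omega$. Suppose $\Omega$ is convex in a neighborhood $U\subset\mathbb{R}^{n}$ of $p$. Then the signed distance-to-the-boundary function $\delta_{b\Omega}$ is convex on $b\Omega\cap U$, i.e. $\sum_{j,k=1}^{n}\frac{\partial^{2}\delta_{b\Omega}}{\partial x_{j}\partial x_{k}}(x)\,\xi_{j}\xi_{k}\geq 0$ for all $x\in b\Omega\cap U$ and all $\xi\in\mathbb{R}^{n}$.
   Context: Smooth means $C^{\infty}$; neighborhoods are open; $b\Omega$ denotes the topological boundary of $\Omega$. An open set $\Omega\subset\mathbb{R}^{n}$ is smoothly bounded if there is a $C^{\infty}$ function $r:\mathbb{R}^{n}\to\mathbb{R}$ (a defining function) with $\Omega=\{r<0\}$ and $\nabla r\neq 0$ in a neighborhood of $\{r=0\}=b\Omega$. The tangent space at $x\in b\Omega$ is $T_{x}(b\Omega)=\{\xi\in\mathbb{R}^{n}:\langle\nabla r(x),\xi\rangle=0\}$; it does not depend on the choice of $r$. $\Omega$ is convex in (on) an open set $U$ if $\sum_{j,k}\frac{\partial^{2}r}{\partial x_{j}\partial x_{k}}(q)\,\tau_{j}\tau_{k}\geq 0$ for all $q\in b\Omega\cap U$ and all $\tau\in T_{q}(b\Omega)$ (this does not depend on the choice of $r$). With $d_{b\Omega}(x)=\inf\{\|x-z\|:z\in b\Omega\}$ the Euclidean distance to $b\Omega$, the signed distance-to-the-boundary function is $\delta_{b\Omega}(x)=-d_{b\Omega}(x)$ for $x\in\Omega$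 and $\delta_{b\Omega}(x)=d_{b\Omega}(x)$ for $x\in\mathbb{R}^{n}\setminus\Omega$. It is known that $\delta_{b\Omega}$ is $C^\infty$ near every point of $b\Omega$. *)

theory Defs
  imports "HOL-Analysis.Analysis"
begin

definition partial_deriv :: "'n::finite \<Rightarrow> (real^'n \<Rightarrow> real) \<Rightarrow> real^'n \<Rightarrow> real" where
  "partial_deriv j f x = deriv (\<lambda>t. f (x + t *\<^sub>R axis j 1)) 0"

definition grad :: "(real^'n::finite \<Rightarrow> real) \<Rightarrow> real^'n \<Rightarrow> real^'n" where
  "grad f x = (\<chi> j. partial_deriv j f x)"

definition hessian_form :: "(real^'n::finite \<Rightarrow> real) \<Rightarrow> real^'n \<Rightarrow> real^'n \<Rightarrow> real" where
  "hessian_form f x \<xi> =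
     (\<Sum>j\<in>UNIV. \<Sum>k\<in>UNIV. partial_deriv j (partial_deriv k f) x * \<xi> $ j * \<xi> $ k)"

text \<open>\<open>Ck k f\<close>: \<open>f\<close> is of class \<open>C\<^sup>k\<close> on the whole space. Requiring (total) differentiability
  at every level makes each \<^const>\<open>partial_deriv\<close> a genuine derivative rather than an arbitrary
  value of \<^const>\<open>deriv\<close>.\<close>

primrec Ck :: "nat \<Rightarrow> (real^'n::finite \<Rightarrow> real) \<Rightarrow> bool" where
  "Ck 0 f \<longleftrightarrow> continuous_on UNIV f"
| "Ck (Suc k) f \<longleftrightarrow> (\<forall>x. f differentiable (at x)) \<and> (\<forall>j. Ck k (partial_deriv j f))"

definition smooth :: "(real^'n::finite \<Rightarrow> real) \<Rightarrow> bool" where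
  "smooth f \<longleftrightarrow> (\<forall>k. Ck k f)"

definition defining_function :: "(real^'n::finite) set \<Rightarrow> (real^'n \<Rightarrow> real) \<Rightarrow> bool" where
  "defining_function \<Omega> r \<longleftrightarrow>
     smooth r \<and> \<Omega> = {x. r x < 0} \<and> frontier \<Omega> = {x. r x = 0} \<and>
     (\<exists>V. open V \<and> frontier \<Omega> \<subseteq> V \<and> (\<forall>x\<in>V. grad r x \<noteq> 0))"

text \<open>As usual in this setting, ``smoothly bounded'' does not include metric boundedness.\<close>

definition smoothly_bounded :: "(real^'n::finite) set \<Rightarrow> bool" where
  "smoothly_bounded \<Omega> \<longleftrightarrow> open \<Omega> \<and> (\<exists>r. defining_function \<Omega> r)"

definition tangent_space :: "(real^'n::finite \<Rightarrow> real) \<Rightarrow> real^'n \<Rightarrow> (real^'n) set" where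
  "tangent_space r x = {\<xi>. grad r x \<bullet> \<xi> = 0}"

text \<open>The condition does not depend on the choice of \<open>r\<close>. Since it is used as a hypothesis, it
  is stated in the formally weakest way, for some defining function.\<close>

definition convex_in :: "(real^'n::finite) set \<Rightarrow> (real^'n) set \<Rightarrow> bool" where
  "convex_in \<Omega> U \<longleftrightarrow>
     (\<exists>r. defining_function \<Omega> r \<and>
       (\<forall>q \<in> frontier \<Omega> \<inter> U. \<forall>\<tau> \<in> tangent_space r q. hessian_form r q \<tau> \<ge> 0))"

text \<open>\<^const>\<open>infdist\<close> to the empty set is \<open>0\<close> by convention; this is relevant only if the frontier
  of \<open>\<Omega>\<close> is empty.\<close>

definition signed_dist :: "(real^'n::finite) set \<Rightarrow> real^'n \<Rightarrow> real" where
  "signed_dist \<Omega> x =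
     (if x \<in> \<Omega> then - infdist x (frontier \<Omega>) else infdist x (frontier \<Omega>))"

end

theory Submission
  imports Defs
begin

text \<open>
  Let \<open>r\<close> be a defining function with gradient \<open>g\<close> and unit normal field \<open>N = sgn g\<close>. A ball
  touching the boundary at a nearest point \<open>z\<close> of \<open>x\<close> lies on one side of it, so
  \<open>x = z + \<delta>(x) N(z)\<close> with the correct sign. Hence \<open>(z, \<delta>(x))\<close> is the preimage of \<open>(x, 0)\<close> under
  \<open>(y, t) \<mapsto> (y + t N(y), r(y))\<close>, which the inverse function theorem inverts near \<open>(x\<^sub>0, 0)\<close>.
  Differentiating \<open>x = y(x) + \<delta>(x) N(y(x))\<close> and pairing with \<open>N\<close> gives \<open>\<nabla>\<delta> = N \<circ> y\<close>, and
  \<open>Dy(x\<^sub>0)\<close> is the orthogonal projection onto the tangent space. Differentiating once more, the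
  Hessian form of \<open>\<delta>\<close> at \<open>\<xi>\<close> equals that of \<open>r\<close> at the tangential part of \<open>\<xi>\<close>, divided by
  \<open>|g|\<close>.
\<close>

section \<open>Differentiating a unit normal field\<close>

text \<open>Quotient rule for \<open>f y / norm (f y)\<close>. The derivative is written as the part
  of \<open>f' h\<close> orthogonal to \<open>sgn (f x)\<close>, scaled by
  \<open>1 / norm (f x)\<close>, which makes its orthogonality to \<open>sgn (f x)\<close>
  visible.\<close>

lemma has_derivative_sgn:
  fixes f :: "'a::real_normed_vector \<Rightarrow> 'b::real_inner"
  assumes f: "(f has_derivative f') (at x)" and nz: "f x \<noteq> 0"
  shows "((\<lambda>y. sgn (f y)) has_derivative
    (\<lambda>h. (f' h - (f' h \<bullet> sgn (f x)) *\<^sub>R sgn (f x)) /\<^sub>R norm (f x))) (at x)"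
proof -
  have n: "((\<lambda>y. norm (f y)) has_derivative (\<lambda>h. f' h \<bullet> sgn (f x))) (at x)"
    using has_derivative_compose[OF f has_derivative_norm[OF nz]] .
  show ?thesis
    unfolding sgn_div_norm
    by (rule has_derivative_eq_rhs[OF has_derivative_scaleR[OF Deriv.has_derivative_inverse[OF _ n] f]])
      (use nz in \<open>auto simp: fun_eq_iff sgn_div_norm algebra_simps\<close>)
qed

section \<open>Balls touching the zero set\<close>

text \<open>In the expansion of the squared distance from \<open>x\<close> to
  \<open>z + t h\<close>, the negative term linear in \<open>t\<close> beats the quadratic one for
  small \<open>t > 0\<close>.\<close>

lemma descent_into_ball:
  fixes h x z :: "'a::real_inner"
  assumes "h \<bullet> (x - z) > 0"
  shows "\<forall>\<^sub>F t in at_right 0. z + t *\<^sub>R h \<in> ball x (dist x z)"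
proof -
  \<comment> \<open>For \<open>0 < t < c\<close> the quadratic term stays below the linear one; the
    summand 1 makes the denominator visibly positive.\<close>
  define c where "c = h \<bullet> (x - z) / ((norm h)\<^sup>2 + 1)"
  have np: "(norm h)\<^sup>2 + 1 > 0"
    by (simp add: add_nonneg_pos)
  have "c > 0"
    unfolding c_def using assms np by simp
  have "z + t *\<^sub>R h \<in> ball x (dist x z)" if t: "0 < t" "t < c" for t
  proof -
    have "t * ((norm h)\<^sup>2 + 1) < h \<bullet> (x - z)"
      using t(2) np unfolding c_def by (simp add: pos_less_divide_eq)
    then have "t * (norm h)\<^sup>2 < 2 * (h \<bullet> (x - z))"
      using t(1) assms by (simp add: algebra_simps)
    then have "t * (t * (norm h)\<^sup>2) < t * (2 * (h \<bullet> (x - z)))"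
      using t(1) by simp
    moreover have "(norm (x - (z + t *\<^sub>R h)))\<^sup>2
        = (norm (x - z))\<^sup>2 - t * (2 * (h \<bullet> (x - z))) + t * (t * (norm h)\<^sup>2)"
      unfolding power2_norm_eq_inner by (simp add: algebra_simps inner_commute)
    ultimately have "(norm (x - (z + t *\<^sub>R h)))\<^sup>2 < (norm (x - z))\<^sup>2"
      by linarith
    then show ?thesis
      by (simp add: dist_norm power2_less_imp_less)
  qed
  then show ?thesis
    using \<open>c > 0\<close> by (auto simp: eventually_at_right_field)
qed

text \<open>On the ball \<open>r\<close> is at least its value 0 at \<open>z\<close>, so
  \<open>g\<close> is nonnegative on the open half-space of directions entering the ball, and hence
  is a nonnegative multiple of \<open>x - z\<close>. The division-free form also covers
  \<open>x = z\<close> and \<open>g = 0\<close>.\<close>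

lemma gradient_at_touching_ball:
  fixes r :: "'a::real_inner \<Rightarrow> real"
  assumes r: "(r has_derivative (\<lambda>h. g \<bullet> h)) (at z)" and "r z = 0"
    and nonneg: "\<And>y. y \<in> ball x (dist x z) \<Longrightarrow> r y \<ge> 0"
  shows "norm g *\<^sub>R (x - z) = dist x z *\<^sub>R g"
proof (cases "x = z")
  case False
  \<comment> \<open>Otherwise \<open>r\<close> would become negative just after leaving
    \<open>z\<close> along \<open>h\<close>, while already inside the ball.\<close>
  have pos: "g \<bullet> h \<ge> 0" if h: "h \<bullet> (x - z) > 0" for h
  proof (rule ccontr)
    assume "\<not> g \<bullet> h \<ge> 0"
    have "((\<lambda>t. r (z + t *\<^sub>R h)) has_derivative (\<lambda>t. g \<bullet> (t *\<^sub>R h))) (at 0)"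
      by (rule has_derivative_compose[of _ _ _ _ r]) (auto intro!: derivative_eq_intros r)
    then have "((\<lambda>t. r (z + t *\<^sub>R h)) has_real_derivative g \<bullet> h) (at 0)"
      by (simp add: has_field_derivative_def mult_commute_abs)
    from has_real_derivative_neg_dec_right[OF this] \<open>\<not> g \<bullet> h \<ge> 0\<close>
    obtain d where "d > 0" "\<And>t. 0 < t \<Longrightarrow> t < d \<Longrightarrow> r (z + t *\<^sub>R h) < 0"
      using \<open>r z = 0\<close> by auto
    then have "\<forall>\<^sub>F t in at_right 0. r (z + t *\<^sub>R h) < 0"
      by (auto simp: eventually_at_right_field)
    with descent_into_ball[OF h] have "\<forall>\<^sub>F t in at_right (0::real). False"
      by eventually_elim (use nonneg in force)
    then show False
      by simp
  qed
  define u where "u = sgn (x - z)"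
  define w where "w = g - (g \<bullet> u) *\<^sub>R u"
  have xz: "x - z = dist x z *\<^sub>R u" "norm u = 1" "dist x z > 0"
    using False by (auto simp: u_def norm_sgn sgn_div_norm dist_norm)
  then have uu: "u \<bullet> u = 1"
    by (simp add: norm_eq_1)
  have "w \<bullet> u = 0"
    unfolding w_def by (simp add: inner_diff_left uu)
  then have gw: "g \<bullet> w = w \<bullet> w"
    unfolding w_def by (simp add: algebra_simps inner_commute)
  \<comment> \<open>The component \<open>w\<close> of \<open>g\<close> orthogonal to
    \<open>u\<close> must vanish. The vector \<open>e u - w\<close> enters the ball for every
    \<open>e > 0\<close>, and testing \<open>g\<close> on it bounds \<open>w \<bullet> w\<close> by
    a multiple of \<open>e\<close>.\<close>
  have le: "w \<bullet> w \<le> e * (g \<bullet> u)" if "e > 0" for e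
  proof -
    have "(e *\<^sub>R u - w) \<bullet> (x - z) = dist x z * e"
      unfolding xz(1) using \<open>w \<bullet> u = 0\<close> by (simp add: inner_diff_left uu)
    then have "g \<bullet> (e *\<^sub>R u - w) \<ge> 0"
      using that xz(3) by (intro pos) (simp only: mult_pos_pos)
    then show ?thesis
      by (simp add: gw inner_diff_right)
  qed
  have gu: "g \<bullet> u \<ge> 0"
    using pos[of u] unfolding xz(1) using xz(3) by (simp add: uu)
  have "w \<bullet> w \<le> 0"
  proof (rule field_le_epsilon)
    fix e :: real assume "e > 0"
    \<comment> \<open>Scaling by \<open>g \<bullet> u + 1\<close> instead of
      \<open>g \<bullet> u\<close> avoids dividing by zero.\<close>
    have "w \<bullet> w \<le> e / (g \<bullet> u + 1) * (g \<bullet> u)"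
      using gu \<open>e > 0\<close> by (intro le) auto
    also have "\<dots> \<le> 0 + e"
      using gu \<open>e > 0\<close> by (simp add: field_simps)
    finally show "w \<bullet> w \<le> 0 + e" .
  qed
  then have "w = 0"
    using inner_gt_zero_iff[of w] by linarith
  then have "g = (g \<bullet> u) *\<^sub>R u"
    by (simp add: w_def)
  moreover from this have "norm g = g \<bullet> u"
    using gu xz(2) by (metis abs_of_nonneg mult.right_neutral norm_scaleR)
  ultimately show ?thesis
    using xz(1) by (metis scaleR_scaleR mult.commute)
qed simp

text \<open>Intermediate value argument: the image of the ball is connected, so a negative value
  together with \<open>r x \<ge> 0\<close> would force a zero.\<close>

lemma nonneg_on_ball_avoiding_zeros:
  fixes r :: "'a::real_normed_vector \<Rightarrow> real"
  assumes "continuous_on UNIV r" and "r x \<ge> 0" and "\<And>y. y \<in> ball x d \<Longrightarrow> r y \<noteq> 0"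
    and "y \<in> ball x d"
  shows "r y \<ge> 0"
proof (rule ccontr)
  assume "\<not> r y \<ge> 0"
  have con: "connected (r ` ball x d)"
    by (intro connected_continuous_image continuous_on_subset[OF assms(1)]) auto
  have "dist x y < d"
    using assms(4) by simp
  then have "x \<in> ball x d"
    using zero_le_dist[of x y] by (simp del: zero_le_dist)
  then have "0 \<in> r ` ball x d"
    using con assms(2,4) \<open>\<not> r y \<ge> 0\<close> connectedD_interval[of "r ` ball x d" "r y" "r x" 0] by auto
  then show False
    using assms(3) by auto
qed

section \<open>Foot points and the gradient of the signed distance\<close>

text \<open>The ball around \<open>x\<close> through a nearest boundary point contains no zero of
  \<open>r\<close>, so it touches from one side. Inside \<Omega> the touching lemma is applied to
  \<open>- r\<close>, and the resulting change of sign is the one built into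
  \<open>signed_dist\<close>.\<close>

lemma signed_dist_foot_point:
  fixes \<Omega> :: "(real^'n::finite) set" and r :: "real^'n \<Rightarrow> real"
  assumes r: "\<And>x. (r has_derivative (\<lambda>h. g x \<bullet> h)) (at x)"
    and \<Omega>: "\<Omega> = {x. r x < 0}" "frontier \<Omega> = {x. r x = 0}"
    and g: "\<And>x. r x = 0 \<Longrightarrow> g x \<noteq> 0"
    and ne: "frontier \<Omega> \<noteq> {}"
  obtains z where "r z = 0" "dist x z = infdist x (frontier \<Omega>)"
    "x = z + signed_dist \<Omega> x *\<^sub>R sgn (g z)"
proof -
  obtain z where z: "z \<in> frontier \<Omega>" "infdist x (frontier \<Omega>) = dist x z"
    using infdist_attains_inf[OF frontier_closed ne] by blast
  have "r z = 0"
    using z(1) \<Omega>(2) by simp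
  have cont: "continuous_on UNIV r"
    using r by (meson has_derivative_continuous continuous_at_imp_continuous_on)
  have avoid: "r y \<noteq> 0" if "y \<in> ball x (dist x z)" for y
  proof
    assume "r y = 0"
    then have "infdist x (frontier \<Omega>) \<le> dist x y"
      by (intro infdist_le) (simp add: \<Omega>(2))
    with that z(2) show False
      by simp
  qed
  have "x - z = signed_dist \<Omega> x *\<^sub>R sgn (g z)"
  proof (cases "r x < 0")
    case True
    have "- r y \<ge> 0" if "y \<in> ball x (dist x z)" for y
      by (rule nonneg_on_ball_avoiding_zeros[OF continuous_on_minus[OF cont] _ _ that])
        (use True avoid in auto)
    moreover have "((\<lambda>x. - r x) has_derivative (\<lambda>h. - g z \<bullet> h)) (at z)"
      using has_derivative_minus[OF r] by simp
    ultimately have "norm (- g z) *\<^sub>R (x - z) = dist x z *\<^sub>R (- g z)"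
      using \<open>r z = 0\<close> by (intro gradient_at_touching_ball[of "\<lambda>x. - r x"]) auto
    then have "inverse (norm (g z)) *\<^sub>R (norm (g z) *\<^sub>R (x - z))
        = inverse (norm (g z)) *\<^sub>R (- dist x z *\<^sub>R g z)"
      by simp
    then have "x - z = - dist x z *\<^sub>R sgn (g z)"
      using g[OF \<open>r z = 0\<close>] by (simp add: sgn_div_norm mult.commute)
    moreover have "x \<in> \<Omega>"
      using True \<Omega>(1) by blast
    ultimately show ?thesis
      by (simp add: signed_dist_def z(2))
  next
    case False
    have "r y \<ge> 0" if "y \<in> ball x (dist x z)" for y
      by (rule nonneg_on_ball_avoiding_zeros[OF cont _ _ that]) (use False avoid in auto)
    then have "norm (g z) *\<^sub>R (x - z) = dist x z *\<^sub>R g z"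
      using \<open>r z = 0\<close> by (intro gradient_at_touching_ball[OF r])
    then have "inverse (norm (g z)) *\<^sub>R (norm (g z) *\<^sub>R (x - z))
        = inverse (norm (g z)) *\<^sub>R (dist x z *\<^sub>R g z)"
      by simp
    then have "x - z = dist x z *\<^sub>R sgn (g z)"
      using g[OF \<open>r z = 0\<close>] by (simp add: sgn_div_norm mult.commute)
    moreover have "x \<notin> \<Omega>"
      using False \<Omega>(1) by blast
    ultimately show ?thesis
      by (simp add: signed_dist_def z(2))
  qed
  then show thesis
    using that[OF \<open>r z = 0\<close>] z(2) by (simp add: algebra_simps)
qed

text \<open>The gradient is needed on a whole neighborhood \<open>W\<close> in order to be
  differentiated again. The derivative of the foot point map \<open>y\<close> is needed only at
  \<open>x\<^sub>0\<close>, where it is the tangential projection.\<close>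

lemma signed_dist_gradient:
  fixes \<Omega> :: "(real^'n::finite) set" and r :: "real^'n \<Rightarrow> real"
  assumes r: "\<And>x. (r has_derivative (\<lambda>h. g x \<bullet> h)) (at x)"
    and A: "\<And>x. (g has_derivative A x) (at x)"
    and contA: "\<And>h. continuous_on UNIV (\<lambda>x. A x h)"
    and \<Omega>: "\<Omega> = {x. r x < 0}" "frontier \<Omega> = {x. r x = 0}"
    and g: "\<And>x. r x = 0 \<Longrightarrow> g x \<noteq> 0"
    and x0: "x\<^sub>0 \<in> frontier \<Omega>"
  obtains W y where "open W" "x\<^sub>0 \<in> W" "y x\<^sub>0 = x\<^sub>0"
    "\<And>x. x \<in> W \<Longrightarrow> (signed_dist \<Omega> has_derivative (\<lambda>h. sgn (g (y x)) \<bullet> h)) (at x)"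
    "(y has_derivative (\<lambda>h. h - (sgn (g x\<^sub>0) \<bullet> h) *\<^sub>R sgn (g x\<^sub>0))) (at x\<^sub>0)"
proof -
  define N where "N = (\<lambda>y. sgn (g y))"
  define D where "D = {y. g y \<noteq> 0}"
  define DN where "DN = (\<lambda>y h. (A y h - (A y h \<bullet> N y) *\<^sub>R N y) /\<^sub>R norm (g y))"
  define H where "H = (\<lambda>p. (fst p + snd p *\<^sub>R N (fst p), r (fst p)))"
  define H' where "H' = (\<lambda>p q. (fst q + (snd p *\<^sub>R DN (fst p) (fst q) + snd q *\<^sub>R N (fst p)), g (fst p) \<bullet> fst q))"
  have rx0: "r x\<^sub>0 = 0"
    using x0 \<Omega>(2) by simp
  have contg: "continuous_on S g" for S
    using A by (meson has_derivative_continuous continuous_at_imp_continuous_on)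
  have "open D"
    unfolding D_def by (rule open_Collect_neq) (auto intro: contg)
  have DN: "(N has_derivative DN y) (at y)" if "y \<in> D" for y
    using that has_derivative_sgn[OF A] unfolding N_def DN_def D_def by auto
  have NN: "N y \<bullet> N y = 1" if "y \<in> D" for y
    using that by (simp add: N_def D_def norm_sgn flip: norm_eq_1)
  \<comment> \<open>The unit field \<open>N\<close> has constant length, so its derivative is
    orthogonal to it.\<close>
  have NDN: "N y \<bullet> DN y h = 0" if "y \<in> D" for y h
    using NN[OF that] by (simp add: DN_def inner_diff_right inner_commute)
  have gN: "g y = norm (g y) *\<^sub>R N y" for y
    by (cases "g y = 0") (simp_all add: N_def sgn_div_norm)
  have H: "(H has_derivative H' p) (at p)" if "p \<in> D \<times> UNIV" for p
  proof -
    have N: "((\<lambda>q. N (fst q)) has_derivative (\<lambda>q. DN (fst p) (fst q))) (at p)"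
      using that by (intro has_derivative_compose[OF _ DN] has_derivative_fst has_derivative_ident) auto
    have r': "((\<lambda>q. r (fst q)) has_derivative (\<lambda>q. g (fst p) \<bullet> fst q)) (at p)"
      by (intro has_derivative_compose[OF _ r] has_derivative_fst has_derivative_ident)
    show ?thesis
      unfolding H_def H'_def
      by (intro has_derivative_Pair r' has_derivative_add has_derivative_scaleR N
          has_derivative_fst has_derivative_snd has_derivative_ident)
  qed
  have bl: "bounded_linear (H' p)" if "p \<in> D \<times> UNIV" for p
    using H[OF that] by (rule has_derivative_bounded_linear)
  \<comment> \<open>\<open>inverse_function_theorem\<close> expects the derivative as a continuous
    map into bounded operators. In finite dimension this follows from continuity of
    \<open>H' p q\<close> in \<open>p\<close> for each fixed \<open>q\<close>.\<close>
  define F where "F = (\<lambda>p. Blinfun (H' p))"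
  have F: "blinfun_apply (F p) = H' p" if "p \<in> D \<times> UNIV" for p
    unfolding F_def by (rule bounded_linear_Blinfun_apply[OF bl[OF that]])
  have contH': "continuous_on (D \<times> UNIV) (\<lambda>p. H' p q)" for q
  proof -
    have "continuous_on (D \<times> UNIV) (\<lambda>p::(real^'n) \<times> real. A (fst p) (fst q))"
      by (rule continuous_on_compose2[OF contA]) (auto intro: continuous_on_fst)
    moreover have "continuous_on (D \<times> UNIV) (\<lambda>p::(real^'n) \<times> real. g (fst p))"
      by (rule continuous_on_compose2[OF contg]) (auto intro: continuous_on_fst)
    ultimately show ?thesis
      unfolding H'_def DN_def N_def sgn_div_norm
      by (intro continuous_intros) (auto simp: D_def)
  qed
  have contF: "continuous_on (D \<times> UNIV) F"
  proof (rule continuous_on_blinfun_componentwise)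
    fix i :: "(real^'n) \<times> real"
    show "continuous_on (D \<times> UNIV) (\<lambda>p. blinfun_apply (F p) i)"
      using contH'[of i] by (rule continuous_on_eq) (simp add: F)
  qed
  have p0: "(x\<^sub>0, 0) \<in> D \<times> UNIV"
    using g[OF rx0] by (simp add: D_def)
  \<comment> \<open>At \<open>t = 0\<close> the \<open>DN\<close> term drops out. For a kernel
    vector \<open>q\<close>, the second component makes \<open>fst q\<close> tangential and the
    first makes it normal, so both entries vanish.\<close>
  have inj: "inj (H' (x\<^sub>0, 0))"
  proof -
    have lin: "linear (H' (x\<^sub>0, 0))"
      using bl[OF p0] by (rule bounded_linear.linear)
    have "q = 0" if "H' (x\<^sub>0, 0) q = 0" for q
    proof -
      have 1: "fst q + snd q *\<^sub>R N x\<^sub>0 = 0" and 2: "g x\<^sub>0 \<bullet> fst q = 0"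
        using that by (simp_all add: H'_def zero_prod_def)
      from 2 g[OF rx0] have "N x\<^sub>0 \<bullet> fst q = 0"
        by (subst (asm) gN) simp
      moreover have "N x\<^sub>0 \<bullet> (fst q + snd q *\<^sub>R N x\<^sub>0) = 0"
        using 1 by simp
      ultimately have "snd q = 0"
        using NN[of x\<^sub>0] p0 by (auto simp: inner_add_right)
      with 1 show ?thesis
        by (simp add: prod_eq_iff)
    qed
    then show ?thesis
      using linear_injective_0[OF lin] by blast
  qed
  obtain L where L: "linear L" "L \<circ> H' (x\<^sub>0, 0) = id"
    using linear_injective_left_inverse[OF bounded_linear.linear[OF bl[OF p0]] inj] by blast
  have invF: "Blinfun L o\<^sub>L F (x\<^sub>0, 0) = id_blinfun"
  proof (rule blinfun_eqI)
    fix q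
    show "blinfun_apply (Blinfun L o\<^sub>L F (x\<^sub>0, 0)) q = blinfun_apply id_blinfun q"
      using fun_cong[OF L(2), of q] L(1)
      by (simp add: F[OF p0] bounded_linear_Blinfun_apply linear_conv_bounded_linear)
  qed
  have openD: "open (D \<times> (UNIV :: real set))"
    using \<open>open D\<close> by (simp add: open_Times)
  have derH: "(H has_derivative blinfun_apply (F p)) (at p)" if "p \<in> D \<times> UNIV" for p
    using H[OF that] F[OF that] by simp
  obtain U' V G G' where U': "open U'" "U' \<subseteq> D \<times> UNIV" "(x\<^sub>0, 0) \<in> U'"
    and V: "open V" "H (x\<^sub>0, 0) \<in> V"
    and hom: "homeomorphism U' V H G"
    and G: "\<And>q. q \<in> V \<Longrightarrow> (G has_derivative (G' q)) (at q)"
    and G': "\<And>q. q \<in> V \<Longrightarrow> G' q = inv (blinfun_apply (F (G q)))"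
    and bij: "\<And>q. q \<in> V \<Longrightarrow> bij (blinfun_apply (F (G q)))"
    by (rule inverse_function_theorem[OF openD derH contF p0 invF]) blast+
  have GH: "G (H p) = p" if "p \<in> U'" for p
    using hom that by (simp add: homeomorphism_apply1)
  have GU': "G q \<in> U'" if "q \<in> V" for q
    using hom that by (auto simp: homeomorphism_def)
  have Hx0: "H (x\<^sub>0, 0) = (x\<^sub>0, 0)"
    by (simp add: H_def rx0)
  obtain P Q where PQ: "open P" "open Q" "x\<^sub>0 \<in> P" "0 \<in> Q" "P \<times> Q \<subseteq> U'"
    using open_prod_elim[OF U'(1,3)] by (metis mem_Sigma_iff)
  obtain a where a: "a > 0" "ball x\<^sub>0 a \<subseteq> P"
    using PQ(1,3) open_contains_ball by blast
  obtain b where b: "b > 0" "ball 0 b \<subseteq> Q"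
    using PQ(2,4) open_contains_ball by blast
  \<comment> \<open>Since \<open>dist x z \<le> dist x x\<^sub>0\<close> for the foot point
    \<open>z\<close>, the radius \<open>a / 2\<close> keeps \<open>z\<close> within \<open>a\<close>
    of \<open>x\<^sub>0\<close>, and the radius \<open>b\<close> bounds the signed distance. The
    last set makes \<open>G\<close> differentiable at \<open>(x, 0)\<close>.\<close>
  define W where "W = ball x\<^sub>0 (a / 2) \<inter> ball x\<^sub>0 b \<inter> (\<lambda>x. (x, 0)) -` V"
  have "open ((\<lambda>x. (x, 0::real)) -` V)"
    using V(1) by (intro open_vimage continuous_intros)
  then have "open W"
    unfolding W_def by auto
  have "x\<^sub>0 \<in> W"
    unfolding W_def using a(1) b(1) V(2) by (simp add: Hx0)
  define y where "y = (\<lambda>x. fst (G (x, 0)))"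
  \<comment> \<open>The pair of foot point and signed distance lies in \<open>U'\<close> and is sent
    by \<open>H\<close> to \<open>(x, 0)\<close>, so it is the preimage that \<open>G\<close>
    selects.\<close>
  have G_eq: "G (x, 0) = (y x, signed_dist \<Omega> x)" if "x \<in> W" for x
  proof -
    obtain z where z: "r z = 0" "dist x z = infdist x (frontier \<Omega>)"
      "x = z + signed_dist \<Omega> x *\<^sub>R sgn (g z)"
      using signed_dist_foot_point[OF r \<Omega> g] x0 by blast
    have le: "dist x z \<le> dist x x\<^sub>0"
      unfolding z(2) by (rule infdist_le[OF x0])
    have "dist x\<^sub>0 z \<le> dist x\<^sub>0 x + dist x z"
      by (rule dist_triangle)
    then have "z \<in> ball x\<^sub>0 a"
      using that le unfolding W_def by (simp add: dist_commute)
    moreover have "\<bar>signed_dist \<Omega> x\<bar> = dist x z"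
      by (simp add: signed_dist_def z(2) infdist_nonneg)
    then have "signed_dist \<Omega> x \<in> ball 0 b"
      using that le unfolding W_def by (simp add: dist_commute)
    ultimately have "(z, signed_dist \<Omega> x) \<in> U'"
      using a(2) b(2) PQ(5) by blast
    moreover have "H (z, signed_dist \<Omega> x) = (x, 0)"
      using z(1,3) by (simp add: H_def N_def)
    ultimately show ?thesis
      using GH by (metis fst_conv y_def)
  qed
  have yx0: "y x\<^sub>0 = x\<^sub>0"
    unfolding y_def using GH[OF U'(3)] by (simp add: Hx0)
  define d' where "d' = (\<lambda>x h. snd (G' (x, 0) (h, 0)))"
  define y' where "y' = (\<lambda>x h. fst (G' (x, 0) (h, 0)))"
  have der: "(signed_dist \<Omega> has_derivative d' x) (at x)" "(y has_derivative y' x) (at x)"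
    if x: "x \<in> W" for x
  proof -
    have *: "((\<lambda>x. G (x, 0)) has_derivative (\<lambda>h. G' (x, 0) (h, 0))) (at x)"
      using x by (intro has_derivative_compose[OF _ G] has_derivative_Pair has_derivative_ident has_derivative_const)
        (simp add: W_def)
    show "(y has_derivative y' x) (at x)"
      unfolding y_def y'_def by (rule has_derivative_fst[OF *])
    show "(signed_dist \<Omega> has_derivative d' x) (at x)"
      unfolding d'_def
      by (rule has_derivative_transform_within_open[OF has_derivative_snd[OF *] \<open>open W\<close> x]) (simp add: G_eq)
  qed
  \<comment> \<open>These are the two components of \<open>H'\<close> applied to
    \<open>G' (x, 0) (h, 0)\<close>, which must return \<open>(h, 0)\<close>.\<close>
  have eqs: "y' x h + (signed_dist \<Omega> x *\<^sub>R DN (y x) (y' x h) + d' x h *\<^sub>R N (y x)) = h"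
    "N (y x) \<bullet> y' x h = 0" "y x \<in> D" if x: "x \<in> W" for x h
  proof -
    have V: "(x, 0) \<in> V"
      using x by (simp add: W_def)
    then have inD: "(y x, signed_dist \<Omega> x) \<in> D \<times> UNIV"
      using GU'[OF V] U'(2) G_eq[OF x] by auto
    then show yD: "y x \<in> D"
      by simp
    have "H' (y x, signed_dist \<Omega> x) (G' (x, 0) (h, 0)) = (h, 0)"
      using bij[OF V] unfolding G'[OF V] G_eq[OF x] F[OF inD]
      by (simp add: bij_is_surj surj_f_inv_f)
    then show "y' x h + (signed_dist \<Omega> x *\<^sub>R DN (y x) (y' x h) + d' x h *\<^sub>R N (y x)) = h"
      and "N (y x) \<bullet> y' x h = 0"
      using yD by (auto simp: H'_def y'_def d'_def N_def D_def sgn_div_norm)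
  qed
  \<comment> \<open>Pairing with \<open>N (y x)\<close> leaves only the \<open>d'\<close> term, the
    other two being tangential.\<close>
  have d': "d' x h = N (y x) \<bullet> h" if x: "x \<in> W" for x h
  proof -
    have "N (y x) \<bullet> h = N (y x) \<bullet> (y' x h + (signed_dist \<Omega> x *\<^sub>R DN (y x) (y' x h) + d' x h *\<^sub>R N (y x)))"
      using eqs(1)[OF x] by simp
    also have "\<dots> = d' x h"
      using eqs(2,3)[OF x] NN NDN by (simp add: inner_add_right)
    finally show ?thesis ..
  qed
  have "signed_dist \<Omega> x\<^sub>0 = 0"
    using x0 by (simp add: signed_dist_def)
  then have y'x0: "y' x\<^sub>0 = (\<lambda>h. h - (N x\<^sub>0 \<bullet> h) *\<^sub>R N x\<^sub>0)"
    using eqs(1)[OF \<open>x\<^sub>0 \<in> W\<close>] d'[OF \<open>x\<^sub>0 \<in> W\<close>] yx0 by (simp add: fun_eq_iff eq_diff_eq)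
  have "d' x = (\<lambda>h. sgn (g (y x)) \<bullet> h)" if "x \<in> W" for x
    using d'[OF that] by (simp add: fun_eq_iff N_def)
  then show thesis
    using that[of W y] \<open>open W\<close> \<open>x\<^sub>0 \<in> W\<close> yx0 der(1) der(2)[OF \<open>x\<^sub>0 \<in> W\<close>]
    unfolding y'x0 N_def by simp
qed

section \<open>From total derivatives to \<open>grad\<close> and \<open>hessian_form\<close>\<close>

lemma has_derivative_imp_partial_deriv:
  assumes "(f has_derivative f') (at x)"
  shows "partial_deriv j f x = f' (axis j 1)"
proof -
  interpret bounded_linear f'
    using assms by (rule has_derivative_bounded_linear)
  have "((\<lambda>t. f (x + t *\<^sub>R axis j 1)) has_derivative (\<lambda>t. f' (t *\<^sub>R axis j 1))) (at 0)"
    by (rule has_derivative_compose[of _ _ _ _ f]) (auto intro!: derivative_eq_intros assms)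
  then have "((\<lambda>t. f (x + t *\<^sub>R axis j 1)) has_real_derivative f' (axis j 1)) (at 0)"
    by (simp add: has_field_derivative_def mult_commute_abs scaleR)
  then show ?thesis
    unfolding partial_deriv_def by (rule DERIV_imp_deriv)
qed

lemma has_derivative_imp_grad:
  assumes "(f has_derivative f') (at x)"
  shows "f' = (\<lambda>h. grad f x \<bullet> h)"
proof
  fix h
  interpret bounded_linear f'
    using assms by (rule has_derivative_bounded_linear)
  have "f' h = f' (\<Sum>j\<in>UNIV. h $ j *\<^sub>R axis j 1)"
    by (simp add: basis_expansion flip: scalar_mult_eq_scaleR)
  also have "\<dots> = grad f x \<bullet> h"
    by (simp add: sum scaleR inner_vec_def grad_def has_derivative_imp_partial_deriv[OF assms] mult.commute)
  finally show "f' h = grad f x \<bullet> h" .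
qed

text \<open>The entries of the matrix of \<open>A\<close> are the iterated partial derivatives,
  since component \<open>k\<close> of \<open>grad f\<close> is \<open>partial_deriv k f\<close>.
  This replaces the double sum by an inner product.\<close>

lemma hessian_form_eq_inner:
  assumes "(grad f has_derivative A) (at x)"
  shows "hessian_form f x \<xi> = A \<xi> \<bullet> \<xi>"
proof -
  have pd: "partial_deriv j (partial_deriv k f) x = A (axis j 1) $ k" for j k
  proof -
    have "((\<lambda>y. grad f y $ k) has_derivative (\<lambda>h. A h $ k)) (at x)"
      using assms by (rule bounded_linear.has_derivative[OF bounded_linear_vec_nth])
    then show ?thesis
      by (intro has_derivative_imp_partial_deriv) (simp add: grad_def)
  qed
  interpret bounded_linear A
    using assms by (rule has_derivative_bounded_linear)
  have "A \<xi> = A (\<Sum>j\<in>UNIV. \<xi> $ j *\<^sub>R axis j 1)"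
    by (simp add: basis_expansion flip: scalar_mult_eq_scaleR)
  also have "\<dots> = (\<Sum>j\<in>UNIV. \<xi> $ j *\<^sub>R A (axis j 1))"
    by (simp add: sum scaleR)
  finally have "A \<xi> \<bullet> \<xi> = (\<Sum>j\<in>UNIV. \<xi> $ j * (A (axis j 1) \<bullet> \<xi>))"
    by (simp add: inner_sum_left)
  then show ?thesis
    by (simp add: hessian_form_def pd inner_vec_def sum_distrib_left mult_ac)
qed

section \<open>Comparing the Hessians of the signed distance and of \<open>r\<close>\<close>

theorem corollary5p7:
  fixes \<Omega> U :: "(real^'n::finite) set" and p :: "real^'n"
  assumes "smoothly_bounded \<Omega>" and "connected \<Omega>"
    and "p \<in> frontier \<Omega>"
    and "open U" and "p \<in> U"
    and "convex_in \<Omega> U"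
  shows "\<forall>x \<in> frontier \<Omega> \<inter> U. \<forall>\<xi>. hessian_form (signed_dist \<Omega>) x \<xi> \<ge> 0"
proof (intro ballI allI)
  fix x \<xi> assume x: "x \<in> frontier \<Omega> \<inter> U"
  obtain r where def_r: "defining_function \<Omega> r"
    and conv: "\<And>q \<tau>. \<lbrakk>q \<in> frontier \<Omega> \<inter> U; \<tau> \<in> tangent_space r q\<rbrakk> \<Longrightarrow> hessian_form r q \<tau> \<ge> 0"
    using assms(6) unfolding convex_in_def by blast
  have \<Omega>: "\<Omega> = {x. r x < 0}" "frontier \<Omega> = {x. r x = 0}"
    and g: "\<And>x. r x = 0 \<Longrightarrow> grad r x \<noteq> 0"
    using def_r unfolding defining_function_def by blast+
  have "Ck (Suc (Suc 0)) r"
    using def_r unfolding defining_function_def smooth_def by blast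
  then have diff: "\<And>x. r differentiable (at x)" "\<And>k x. partial_deriv k r differentiable (at x)"
    and cont: "\<And>j k. continuous_on UNIV (partial_deriv j (partial_deriv k r))"
    by auto
  have r: "(r has_derivative (\<lambda>h. grad r x \<bullet> h)) (at x)" for x
    using diff(1)[of x] has_derivative_imp_grad unfolding differentiable_def by metis
  have pd: "(partial_deriv k r has_derivative (\<lambda>h. grad (partial_deriv k r) x \<bullet> h)) (at x)" for k x
    using diff(2)[of k x] has_derivative_imp_grad unfolding differentiable_def by metis
  \<comment> \<open>\<open>A x\<close> is the Hessian of \<open>r\<close> as a linear map; only two
    orders of smoothness enter.\<close>
  define A where "A = (\<lambda>x h. \<chi> k. grad (partial_deriv k r) x \<bullet> h)"
  have A: "(grad r has_derivative A x) (at x)" for x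
    unfolding A_def grad_def[of r]
    by (subst has_derivative_componentwise_within) (auto simp: Basis_vec_def inner_axis pd)
  have contA: "continuous_on UNIV (\<lambda>x. A x h)" for h
    unfolding A_def inner_vec_def grad_def by (intro continuous_intros cont)
  obtain W y where W: "open W" "x \<in> W" and y: "y x = x"
    and d: "\<And>x. x \<in> W \<Longrightarrow> (signed_dist \<Omega> has_derivative (\<lambda>h. sgn (grad r (y x)) \<bullet> h)) (at x)"
    and y': "(y has_derivative (\<lambda>h. h - (sgn (grad r x) \<bullet> h) *\<^sub>R sgn (grad r x))) (at x)"
    using signed_dist_gradient[OF r A contA \<Omega> g] x by blast
  define n where "n = sgn (grad r x)"
  define \<tau> where "\<tau> = \<xi> - (n \<bullet> \<xi>) *\<^sub>R n"
  have gx: "grad r x \<noteq> 0"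
    using g x \<Omega>(2) by blast
  then have nn: "n \<bullet> n = 1"
    by (simp add: n_def norm_sgn flip: norm_eq_1)
  have grad_d: "grad (signed_dist \<Omega>) x = sgn (grad r (y x))" if "x \<in> W" for x
    using has_derivative_imp_grad[OF d[OF that]] by (metis vector_eq_rdot inner_commute)
  \<comment> \<open>Chain rule for \<open>sgn\<close>, \<open>grad r\<close> and \<open>y\<close>:
    the inner projection is the derivative of \<open>y\<close>, the outer one comes from
    \<open>sgn\<close>.\<close>
  let ?B = "\<lambda>h. (A x (h - (n \<bullet> h) *\<^sub>R n) - (A x (h - (n \<bullet> h) *\<^sub>R n) \<bullet> n) *\<^sub>R n) /\<^sub>R norm (grad r x)"
  have "((\<lambda>x. grad r (y x)) has_derivative (\<lambda>h. A x (h - (n \<bullet> h) *\<^sub>R n))) (at x)"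
    using has_derivative_compose[OF y' A] unfolding n_def y .
  from has_derivative_sgn[OF this] gx y
  have "((\<lambda>x. sgn (grad r (y x))) has_derivative ?B) (at x)"
    by (simp add: n_def)
  then have "(grad (signed_dist \<Omega>) has_derivative ?B) (at x)"
    by (rule has_derivative_transform_within_open[OF _ W]) (simp add: grad_d)
  then have "hessian_form (signed_dist \<Omega>) x \<xi> = ?B \<xi> \<bullet> \<xi>"
    by (rule hessian_form_eq_inner)
  \<comment> \<open>The outer projection is self-adjoint, so it can be moved onto \<xi>, turning it
    into \<tau>.\<close>
  also have "\<dots> = (A x \<tau> \<bullet> \<tau>) / norm (grad r x)"
    unfolding \<tau>_def[symmetric]
    by (simp add: \<tau>_def inner_diff_left inner_diff_right divide_inverse_commute inner_commute)
  also have "A x \<tau> \<bullet> \<tau> = hessian_form r x \<tau>"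
    using hessian_form_eq_inner[OF A] by simp
  also have "\<dots> / norm (grad r x) \<ge> 0"
  proof -
    have "n \<bullet> \<tau> = 0"
      by (simp add: \<tau>_def inner_diff_right nn)
    moreover have "grad r x = norm (grad r x) *\<^sub>R n"
      using gx by (simp add: n_def sgn_div_norm)
    ultimately have "grad r x \<bullet> \<tau> = 0"
      by (metis inner_scaleR_left mult_zero_right)
    then show ?thesis
      using conv[OF x] by (simp add: tangent_space_def)
  qed
  finally show "hessian_form (signed_dist \<Omega>) x \<xi> \<ge> 0" .
qed

end
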